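(* Let $A_6$ be the 3-state Mealy automaton over the 2-symbol alphabet $\{x_0,x_1\}$ whose automatic transformations have the unrolled forms $$f_0=(f_0,f_0)(x_1,x_0),\qquad f_1=(f_1,f_2)(x_0,x_1),\qquad f_2=(f_1,f_2)(x_0,x_0).$$ Then: (1) The semigroup $S_{A_6}$ generated by $f_0,f_1,f_2$ has the presentation with generators $f_0,f_1,f_2$ and defining relations (where $1$ is the identity) $$f_0^2=1,\qquad f_2f_1=f_1f_2=f_2^2=f_2,\qquad f_1^2=f_1,\qquad f_2f_0f_1f_0f_2=f_1f_0f_1f_0f_2 .$$ (2) The growth series $\Gamma_{A_6}(X)=\sum_{n\ge0}\gamma_{A_6}(n)X^n$ of $A_6$ is $$\Gamma_{A_6}(X)=\frac{1}{(1-X)^2}\left(2X-1+\frac{1+X+X^3}{1-X^2-X^4}\right).$$ (3) The growth series $\Gamma_{S_{A_6}}(X)=\sum_{n\ge0}\gamma_{S_{A_6}}(n)X^n$ of $S_{A_6}$ is $$\Gamma_{S_{A_6}}(X)=\frac{1}{(1-X)^2}\left(X+\frac{1+X+X^3}{1-X^2-X^4}\right).$$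
   Context: A Mealy automaton with states $q_0,\dots,q_{n-1}$ and input/output alphabet $X_m=\{x_0,\dots,x_{m-1}\}$ has a transition function $\pi:X_m\times Q\to Q$ and an output function $\lambda:X_m\times Q\to X_m$. The state $q_i$ defines an automatic transformation $f_i=f_{q_i}$ of the set of finite (or infinite) words over $X_m$: on input $x u$ ($x$ a letter) it outputs $\lambda(x,q_i)$ followed by $f_{\pi(x,q_i)}(u)$. The unrolled form $f_i=(g_0,\dots,g_{m-1})(y_0,\dots,y_{m-1})$ means $f_i(x_ju)=y_j\,g_j(u)$ for every letter $x_j$ and word $u$. Products of transformations are compositions applied from right to left: $(fg)(u)=f(g(u))$. $S_A$ is the semigroup generated by the automatic transformations under composition; here $S_{A_6}$ contains the identity $1$ (as $f_0^2$), and the presentation is understood as a monoid presentation. The growth function of $A$ is $\gamma_A(n)=|Q_{A^{(n)}}|$, the number of states of the minimal automaton equivalent to the $n$-th power $A^n$ (sequential application); equivalently, for $n\ge1$, the number of distinct transformations of the form $f_{i_1}f_{i_2}\cdots f_{i_n}$ (products of exactly $n$ generators). By convention $\gamma_{A_6}(0)=0$. The growth function of $S_{A_6}$ relative to $\{f_0,f_1,f_2\}$ is $\gamma_{S_{A_6}}(n)=|\{s\in S_{A_6}:\ell(s)\le n\}|$, where $\ell(s)$ is the minimal number of generators in a product equal to $s$, with $\ell(1)=0$. *)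

theory Defs
  imports "HOL-Computational_Algebra.Formal_Power_Series" "HOL-Algebra.Group"
begin

text \<open>The alphabet is the whole type \<open>'x\<close>, the state set is carried explicitly. The
  functions \<open>next_state\<close> and \<open>out_letter\<close> are the functions written \<open>\<pi>\<close> and \<open>\<lambda>\<close> in the theory of
  Mealy automata; only their values at states of the automaton matter.\<close>

record ('x, 'q) mealy =
  states :: "'q set"
  next_state :: "'x \<Rightarrow> 'q \<Rightarrow> 'q"
  out_letter :: "'x \<Rightarrow> 'q \<Rightarrow> 'x"

definition mealy_automaton :: "('x, 'q) mealy \<Rightarrow> bool" where
  "mealy_automaton A \<longleftrightarrow>
     finite (states A) \<and> states A \<noteq> {} \<and> (\<forall>x. \<forall>q\<in>states A. next_state A x q \<in> states A)"

fun transformation :: "('x, 'q) mealy \<Rightarrow> 'q \<Rightarrow> 'x list \<Rightarrow> 'x list" where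
  "transformation A q [] = []"
| "transformation A q (x # u) = out_letter A x q # transformation A (next_state A x q) u"

definition transformations :: "('x, 'q) mealy \<Rightarrow> ('x list \<Rightarrow> 'x list) set" where
  "transformations A = transformation A ` states A"

definition mealy_equivalent :: "('x, 'p) mealy \<Rightarrow> ('x, 'q) mealy \<Rightarrow> bool" where
  "mealy_equivalent A B \<longleftrightarrow> transformations A = transformations B"

text \<open>Every finite automaton is isomorphic to one whose states are natural numbers, so
  restricting the competitors \<open>B\<close> to state type \<^typ>\<open>nat\<close> loses nothing.\<close>

definition minimal_state_number :: "('x, 'q) mealy \<Rightarrow> nat" where
  "minimal_state_number A =
     (LEAST k. \<exists>B :: ('x, nat) mealy.
        mealy_automaton B \<and> mealy_equivalent A B \<and> card (states B) = k)"

text \<open>The \<open>n\<close>-th power of \<open>A\<close> has as states the lists \<open>[q\<^sub>1, \<dots>, q\<^sub>n]\<close>, which stand for the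
  sequential application \<open>f\<^sub>q\<^sub>1 \<circ> \<dots> \<circ> f\<^sub>q\<^sub>n\<close>: a letter first passes through \<open>q\<^sub>n\<close> and last
  through \<open>q\<^sub>1\<close>.\<close>

fun power_output :: "('x, 'q) mealy \<Rightarrow> 'x \<Rightarrow> 'q list \<Rightarrow> 'x" where
  "power_output A x [] = x"
| "power_output A x (q # qs) = out_letter A (power_output A x qs) q"

fun power_next_state :: "('x, 'q) mealy \<Rightarrow> 'x \<Rightarrow> 'q list \<Rightarrow> 'q list" where
  "power_next_state A x [] = []"
| "power_next_state A x (q # qs) =
     next_state A (power_output A x qs) q # power_next_state A x qs"

definition mealy_power :: "('x, 'q) mealy \<Rightarrow> nat \<Rightarrow> ('x, 'q list) mealy" where
  "mealy_power A n =
     \<lparr>states = {qs. set qs \<subseteq> states A \<and> length qs = n},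
      next_state = power_next_state A,
      out_letter = power_output A\<rparr>"

text \<open>The value at \<open>0\<close> is a convention.\<close>

definition automaton_growth :: "('x, 'q) mealy \<Rightarrow> nat \<Rightarrow> nat" where
  "automaton_growth A n = (if n = 0 then 0 else minimal_state_number (mealy_power A n))"

inductive_set automaton_semigroup :: "('x, 'q) mealy \<Rightarrow> ('x list \<Rightarrow> 'x list) set"
  for A :: "('x, 'q) mealy" where
  generator: "q \<in> states A \<Longrightarrow> transformation A q \<in> automaton_semigroup A"
| product: "\<lbrakk>s \<in> automaton_semigroup A; t \<in> automaton_semigroup A\<rbrakk>
    \<Longrightarrow> s \<circ> t \<in> automaton_semigroup A"

text \<open>The structure below is a monoid only if the identity map belongs to the semigroup.\<close>

definition automaton_monoid :: "('x, 'q) mealy \<Rightarrow> ('x list \<Rightarrow> 'x list) monoid" where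
  "automaton_monoid A = \<lparr>carrier = automaton_semigroup A, mult = (\<circ>), one = id\<rparr>"

definition generator_product :: "('x, 'q) mealy \<Rightarrow> 'q list \<Rightarrow> 'x list \<Rightarrow> 'x list" where
  "generator_product A qs = foldr (\<lambda>q s. transformation A q \<circ> s) qs id"

text \<open>The empty product is the identity, which therefore has length \<open>0\<close>.\<close>

definition element_length :: "('x, 'q) mealy \<Rightarrow> ('x list \<Rightarrow> 'x list) \<Rightarrow> nat" where
  "element_length A s =
     (LEAST n. \<exists>qs. set qs \<subseteq> states A \<and> length qs = n \<and> generator_product A qs = s)"

definition semigroup_growth :: "('x, 'q) mealy \<Rightarrow> nat \<Rightarrow> nat" where
  "semigroup_growth A n = card {s \<in> automaton_semigroup A. element_length A s \<le> n}"

text \<open>The generators are the elements of the type \<open>'g\<close>, and elements of the free monoid are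
  lists. The relation below is the least congruence containing \<open>R\<close>.\<close>

inductive congruence_generated :: "('g list \<times> 'g list) set \<Rightarrow> 'g list \<Rightarrow> 'g list \<Rightarrow> bool"
  for R :: "('g list \<times> 'g list) set" where
  base: "(u, v) \<in> R \<Longrightarrow> congruence_generated R u v"
| refl: "congruence_generated R u u"
| sym: "congruence_generated R u v \<Longrightarrow> congruence_generated R v u"
| trans: "\<lbrakk>congruence_generated R u v; congruence_generated R v w\<rbrakk>
    \<Longrightarrow> congruence_generated R u w"
| append: "\<lbrakk>congruence_generated R u v; congruence_generated R u' v'\<rbrakk>
    \<Longrightarrow> congruence_generated R (u @ u') (v @ v')"

definition word_class :: "('g list \<times> 'g list) set \<Rightarrow> 'g list \<Rightarrow> 'g list set" where
  "word_class R u = {v. congruence_generated R u v}"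

text \<open>The product of two classes is the class of \<open>u @ v\<close> for any representatives \<open>u\<close>, \<open>v\<close>; as
  it does not depend on their choice, it is the union over all of them.\<close>

definition presented_monoid :: "('g list \<times> 'g list) set \<Rightarrow> 'g list set monoid" where
  "presented_monoid R =
     \<lparr>carrier = range (word_class R),
      mult = (\<lambda>U V. \<Union>u\<in>U. \<Union>v\<in>V. word_class R (u @ v)),
      one = word_class R []\<rparr>"

definition has_presentation ::
    "('a, 'b) monoid_scheme \<Rightarrow> ('g \<Rightarrow> 'a) \<Rightarrow> ('g list \<times> 'g list) set \<Rightarrow> bool" where
  "has_presentation M g R \<longleftrightarrow>
     monoid M \<and> (\<exists>h \<in> iso (presented_monoid R) M. \<forall>x. h (word_class R [x]) = g x)"

datatype letter = X0 | X1

datatype state = F0 | F1 | F2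

fun A6_next :: "letter \<Rightarrow> state \<Rightarrow> state" where
  "A6_next X0 F0 = F0" | "A6_next X1 F0 = F0"
| "A6_next X0 F1 = F1" | "A6_next X1 F1 = F2"
| "A6_next X0 F2 = F1" | "A6_next X1 F2 = F2"

fun A6_output :: "letter \<Rightarrow> state \<Rightarrow> letter" where
  "A6_output X0 F0 = X1" | "A6_output X1 F0 = X0"
| "A6_output X0 F1 = X0" | "A6_output X1 F1 = X1"
| "A6_output X0 F2 = X0" | "A6_output X1 F2 = X0"

definition A6 :: "(letter, state) mealy" where
  "A6 = \<lparr>states = UNIV, next_state = A6_next, out_letter = A6_output\<rparr>"

lemma A6_unrolled:
  "transformation A6 F0 (X0 # u) = X1 # transformation A6 F0 u"
  "transformation A6 F0 (X1 # u) = X0 # transformation A6 F0 u"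
  "transformation A6 F1 (X0 # u) = X0 # transformation A6 F1 u"
  "transformation A6 F1 (X1 # u) = X1 # transformation A6 F2 u"
  "transformation A6 F2 (X0 # u) = X0 # transformation A6 F1 u"
  "transformation A6 F2 (X1 # u) = X0 # transformation A6 F2 u"
  by (simp_all add: A6_def)

definition A6_relations :: "(state list \<times> state list) set" where
  "A6_relations =
     {([F0, F0], []),
      ([F2, F1], [F2]), ([F1, F2], [F2]), ([F2, F2], [F2]),
      ([F1, F1], [F1]),
      ([F2, F0, F1, F0, F2], [F1, F0, F1, F0, F2])}"

end

theory Submission
  imports Defs "HOL-Number_Theory.Fib"
begin

text \<open>Reading \<open>X1\<close> as 1, both \<open>F1\<close> and \<open>F2\<close> delete every 1 that follows a 1, and differ only at the
  first letter; \<open>F0\<close> is the complement. Hence \<open>F1\<close> or \<open>F2\<close> after \<open>F0\<close> merely shifts a word without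
  two adjacent 1s, so a product \<open>w\<^sub>1 F0 w\<^sub>2 F0 \<dots> F0 w\<^sub>m\<close> with all \<open>w\<^sub>i\<close> in \<open>{F1, F2}\<close> acts like \<open>F1\<close>
  followed by a shift, with a prefix of \<open>m\<close> letters that depends on the first input letter only.
  The choice of \<open>w\<^sub>i\<close> shows in this prefix unless its next letter is constantly 1, which happens
  exactly if the next \<open>F2\<close> follows after an odd number of \<open>F1\<close>. In that case the relations
  turn \<open>w\<^sub>i = F2\<close> into \<open>F1\<close>. This yields canonical words of minimal length, whose numbers are
  governed by Fibonacci numbers. A product of exactly \<open>n\<close> generators can be any element of length
  at most \<open>n\<close> except for the one of \<open>1\<close> and \<open>F0\<close> whose length has the wrong parity.\<close>

section \<open>Minimal automata and powers\<close>

text \<open>For the upper bound, the transformations themselves, numbered by naturals, serve as the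
  states of \<open>B\<close>; its steps are read off from a representative state \<open>r t\<close>.
  The lower bound is that a set of states has at least as many elements as its image.\<close>

lemma minimal_state_number_eq_card:
  fixes A :: "('x, 'q) mealy"
  assumes A: "mealy_automaton A"
  shows "minimal_state_number A = card (transformations A)"
  unfolding minimal_state_number_def
proof (rule Least_equality)
  let ?T = "transformations A"
  have fin: "finite ?T" and ne: "?T \<noteq> {}"
    using A by (auto simp: mealy_automaton_def transformations_def)
  obtain h where h: "bij_betw h {0..<card ?T} ?T"
    using ex_bij_betw_nat_finite[OF fin] by blast
  define r where "r t = (SOME q. q \<in> states A \<and> transformation A q = t)" for t
  have r: "r t \<in> states A \<and> transformation A (r t) = t" if "t \<in> ?T" for t
    unfolding r_def by (rule someI_ex) (use that in \<open>auto simp: transformations_def\<close>)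
  define g where "g = inv_into {0..<card ?T} h"
  have hT: "h k \<in> ?T" if "k < card ?T" for k
    using h that by (auto simp: bij_betw_def)
  have g: "g t < card ?T \<and> h (g t) = t" if "t \<in> ?T" for t
    using h that unfolding g_def
    by (metis atLeastLessThan_iff bij_betw_inv_into_right bij_betw_def inv_into_into)
  have step: "transformation A (next_state A x (r (h k))) \<in> ?T" if "k < card ?T" for x k
    using A r[OF hT[OF that]] by (auto simp: mealy_automaton_def transformations_def)
  define B :: "('x, nat) mealy" where
    "B = \<lparr>states = {0..<card ?T},
          next_state = (\<lambda>x k. g (transformation A (next_state A x (r (h k))))),
          out_letter = (\<lambda>x k. out_letter A x (r (h k)))\<rparr>"
  have "transformation B k u = h k u" if "k < card ?T" for k u
    using that
  proof (induction u arbitrary: k)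
    case Nil
    then show ?case using r[OF hT[OF Nil]] by (metis transformation.simps(1))
  next
    case (Cons x u)
    have "h k (x # u) = transformation A (r (h k)) (x # u)"
      using r[OF hT[OF Cons.prems]] by simp
    then show ?case
      using Cons.IH[of "next_state B x k"] g[OF step[OF Cons.prems]]
      by (simp add: B_def)
  qed
  then have "transformation B k = h k" if "k < card ?T" for k
    using that by blast
  then have "transformations B = h ` {0..<card ?T}"
    unfolding transformations_def[of B] by (intro image_cong) (auto simp: B_def)
  then have "transformations B = ?T"
    using h by (simp add: bij_betw_def)
  moreover have "mealy_automaton B"
    using ne fin g step by (auto simp: mealy_automaton_def B_def card_gt_0_iff)
  ultimately show "\<exists>B :: ('x, nat) mealy.
      mealy_automaton B \<and> mealy_equivalent A B \<and> card (states B) = card ?T"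
    by (intro exI[of _ B]) (simp add: mealy_equivalent_def B_def)
next
  fix k
  assume "\<exists>B :: ('x, nat) mealy.
      mealy_automaton B \<and> mealy_equivalent A B \<and> card (states B) = k"
  then show "card (transformations A) \<le> k"
    by (auto simp: mealy_equivalent_def mealy_automaton_def transformations_def
        intro!: card_image_le)
qed

lemma generator_product_simps [simp]:
  "generator_product A [] = id"
  "generator_product A (q # qs) = transformation A q \<circ> generator_product A qs"
  by (simp_all add: generator_product_def)

lemma generator_product_append:
  "generator_product A (u @ v) = generator_product A u \<circ> generator_product A v"
  by (induction u) (simp_all add: comp_assoc)

lemma generator_product_Nil: "generator_product A qs [] = []"
  by (induction qs) auto

lemma generator_product_Cons:
  "generator_product A qs (x # u) =
    power_output A x qs # generator_product A (power_next_state A x qs) u"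
  by (induction qs) auto

lemma transformation_mealy_power:
  "transformation (mealy_power A n) qs = generator_product A qs"
proof
  show "transformation (mealy_power A n) qs u = generator_product A qs u" for u
    by (induction u arbitrary: qs)
      (simp_all add: generator_product_Nil generator_product_Cons, simp_all add: mealy_power_def)
qed

lemma mealy_automaton_power:
  assumes "mealy_automaton A"
  shows "mealy_automaton (mealy_power A n)"
proof -
  have "set (power_next_state A x qs) \<subseteq> states A" if "set qs \<subseteq> states A" for x qs
    using that assms by (induction qs) (auto simp: mealy_automaton_def)
  moreover have "length (power_next_state A x qs) = length qs" for x qs
    by (induction qs) auto
  \<comment> \<open>A constant list witnesses that the power has a state.\<close>
  moreover obtain q where "q \<in> states A"
    using assms by (auto simp: mealy_automaton_def)
  then have "set (replicate n q) \<subseteq> states A \<and> length (replicate n q) = n"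
    by (auto simp: set_replicate_conv_if)
  ultimately show ?thesis
    using assms finite_lists_length_eq[of "states A" n]
    by (fastforce simp: mealy_automaton_def mealy_power_def)
qed

lemma automaton_growth_eq_card:
  assumes "mealy_automaton A" "n > 0"
  shows "automaton_growth A n =
    card (generator_product A ` {qs. set qs \<subseteq> states A \<and> length qs = n})"
proof -
  have "transformations (mealy_power A n) =
      generator_product A ` {qs. set qs \<subseteq> states A \<and> length qs = n}"
    by (simp add: transformations_def transformation_mealy_power)
      (simp add: mealy_power_def)
  then show ?thesis
    using assms minimal_state_number_eq_card[OF mealy_automaton_power[OF assms(1), of n]]
    by (simp add: automaton_growth_def)
qed

section \<open>Presentations\<close>

text \<open>Homomorphism theorem: \<open>\<phi>\<close> evaluates words in \<open>M\<close>, and its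
  kernel is the congruence generated by \<open>R\<close>, so it factors through the classes.\<close>

lemma has_presentationI:
  assumes M: "monoid M"
    and eq: "\<And>u v. congruence_generated R u v \<longleftrightarrow> \<phi> u = \<phi> v"
    and append: "\<And>u v. \<phi> (u @ v) = \<phi> u \<otimes>\<^bsub>M\<^esub> \<phi> v"
    and carrier: "range \<phi> = carrier M"
  shows "has_presentation M (\<lambda>x. \<phi> [x]) R"
proof -
  define h where "h U = \<phi> (SOME u. u \<in> U)" for U
  have wc: "word_class R u = {v. \<phi> u = \<phi> v}" for u
    by (simp add: word_class_def eq)
  have h: "h (word_class R u) = \<phi> u" for u
  proof -
    have "\<phi> u = \<phi> (SOME v. \<phi> u = \<phi> v)"
      by (rule someI) (rule HOL.refl)
    then show ?thesis by (simp add: h_def wc)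
  qed
  have mult: "(\<Union>u'\<in>word_class R u. \<Union>v'\<in>word_class R v. word_class R (u' @ v')) =
      word_class R (u @ v)" for u v
    by (auto simp: wc append)
  have "h \<in> hom (presented_monoid R) M"
    using carrier by (auto simp: hom_def presented_monoid_def h mult append)
  moreover have "inj_on h (range (word_class R))"
    by (auto simp: inj_on_def h) (auto simp: wc)
  moreover have "h ` range (word_class R) = carrier M"
    by (simp add: image_image h carrier)
  ultimately show ?thesis
    using M by (auto simp: has_presentation_def iso_def bij_betw_def presented_monoid_def h)
qed

section \<open>The action on infinite words\<close>

text \<open>The letter \<open>X1\<close> is read as \<open>True\<close>. The states \<open>F1\<close> and \<open>F2\<close> differ in the virtual letter
  before the start.\<close>

fun act :: "state \<Rightarrow> (nat \<Rightarrow> bool) \<Rightarrow> nat \<Rightarrow> bool" where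
  "act F0 s i = (\<not> s i)"
| "act F1 s 0 = s 0"
| "act F2 s 0 = False"
| "act F1 s (Suc i) = (s (Suc i) \<and> \<not> s i)"
| "act F2 s (Suc i) = (s (Suc i) \<and> \<not> s i)"

definition act_word :: "state list \<Rightarrow> (nat \<Rightarrow> bool) \<Rightarrow> nat \<Rightarrow> bool" where
  "act_word = foldr act"

lemma act_word_simps [simp]:
  "act_word [] s = s"
  "act_word (q # u) s = act q (act_word u s)"
  by (simp_all add: act_word_def)

lemma act_word_append [simp]: "act_word (u @ v) s = act_word u (act_word v s)"
  by (induction u) simp_all

definition letter_of :: "bool \<Rightarrow> letter" where
  "letter_of b = (if b then X1 else X0)"

definition stream_prefix :: "nat \<Rightarrow> (nat \<Rightarrow> bool) \<Rightarrow> letter list" where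
  "stream_prefix n s = map (\<lambda>i. letter_of (s i)) [0..<n]"

lemma stream_prefix_Suc:
  "stream_prefix (Suc n) s = letter_of (s 0) # stream_prefix n (\<lambda>i. s (Suc i))"
  unfolding stream_prefix_def upt_conv_Cons[OF zero_less_Suc] map_Suc_upt[symmetric]
  by simp

text \<open>After one letter only that letter is remembered: the automaton is in \<open>F2\<close>
  after \<open>X1\<close> and in \<open>F1\<close> after \<open>X0\<close>.\<close>

lemma act_shift:
  "q \<noteq> F0 \<Longrightarrow> act q s (Suc i) = act (if s 0 then F2 else F1) (\<lambda>i. s (Suc i)) i"
  by (cases q; cases i) auto

lemma transformation_stream_prefix:
  "transformation A6 q (stream_prefix n s) = stream_prefix n (act q s)"
proof (induction n arbitrary: q s)
  case 0
  then show ?case by (simp add: stream_prefix_def)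
next
  case (Suc n)
  show ?case
    by (cases q; cases "s 0")
      (simp_all add: stream_prefix_Suc Suc.IH act_shift A6_unrolled letter_of_def
        del: transformation.simps act.simps(4,5))
qed

lemma generator_product_stream_prefix:
  "generator_product A6 u (stream_prefix n s) = stream_prefix n (act_word u s)"
  by (induction u) (simp_all add: transformation_stream_prefix)

lemma ex_stream_prefix: "\<exists>n s. xs = stream_prefix n s"
proof (intro exI)
  show "xs = stream_prefix (length xs) (\<lambda>i. xs ! i = X1)"
    by (rule nth_equalityI)
      (auto simp: stream_prefix_def letter_of_def, use letter.exhaust in blast)
qed

lemma stream_prefix_nth: "i < n \<Longrightarrow> stream_prefix n s ! i = letter_of (s i)"
  by (simp add: stream_prefix_def)

text \<open>Every finite word is a prefix of a stream, and every position of a stream lies in a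
  finite prefix.\<close>

lemma generator_product_eq_iff:
  "generator_product A6 u = generator_product A6 v \<longleftrightarrow> act_word u = act_word v"
proof
  assume eq: "generator_product A6 u = generator_product A6 v"
  show "act_word u = act_word v"
  proof (intro ext)
    fix s i
    have "stream_prefix (Suc i) (act_word u s) = stream_prefix (Suc i) (act_word v s)"
      using eq by (metis generator_product_stream_prefix)
    then have "letter_of (act_word u s i) = letter_of (act_word v s i)"
      by (metis stream_prefix_nth lessI)
    then show "act_word u s i = act_word v s i"
      by (simp add: letter_of_def split: if_splits)
  qed
next
  assume "act_word u = act_word v"
  then show "generator_product A6 u = generator_product A6 v"
    by (intro ext) (metis ex_stream_prefix generator_product_stream_prefix)
qed

section \<open>Soundness of the relations\<close>

abbreviation equivalent :: "state list \<Rightarrow> state list \<Rightarrow> bool" (infix "\<approx>" 50) where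
  "u \<approx> v \<equiv> congruence_generated A6_relations u v"

text \<open>Each \<open>F1\<close> or \<open>F2\<close> looks one letter back and a side of a
  relation contains at most three of them. So from position 3 on the start is out of reach, and one
  symbolic case suffices.\<close>

lemma act_word_relation:
  assumes "(u, v) \<in> A6_relations"
  shows "act_word u = act_word v"
proof (intro ext)
  fix s i
  consider "i = 0" | "i = 1" | "i = 2" | j where "i = Suc (Suc (Suc j))"
    by (metis One_nat_def Suc_1 not0_implies_Suc)
  then show "act_word u s i = act_word v s i"
    using assms by cases (auto simp: A6_relations_def numeral_2_eq_2)
qed

lemma act_word_equivalent: "u \<approx> v \<Longrightarrow> act_word u = act_word v"
  by (induction rule: congruence_generated.induct) (auto simp: act_word_relation intro!: ext)

lemma equivalent_context:
  assumes "u \<approx> v"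
  shows "l @ u @ r \<approx> l @ v @ r"
  by (intro congruence_generated.append congruence_generated.refl assms)

lemmas equivalent_trans [trans] = congruence_generated.trans

section \<open>Canonical words\<close>

definition mark :: "bool \<Rightarrow> state" where
  "mark a = (if a then F2 else F1)"

definition blocks :: "bool list \<Rightarrow> state list" where
  "blocks w = concat (map (\<lambda>a. [mark a, F0]) w)"

lemma blocks_simps [simp]:
  "blocks [] = []"
  "blocks (a # w) = mark a # F0 # blocks w"
  "blocks (v @ w) = blocks v @ blocks w"
  by (simp_all add: blocks_def)

lemma length_blocks [simp]: "length (blocks w) = 2 * length w"
  by (induction w) auto

lemma blocks_eq_Nil [simp]: "blocks w = [] \<longleftrightarrow> w = []"
  by (cases w) auto

text \<open>The first letter of the image under \<open>blocks w\<close> as a function of the first letter of the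
  argument.\<close>

fun first_out :: "bool list \<Rightarrow> bool \<Rightarrow> bool" where
  "first_out [] x = x"
| "first_out (a # w) x = (\<not> a \<and> \<not> first_out w x)"

text \<open>If \<open>first_out w\<close> is constantly \<open>True\<close>, then the words \<open>F2 # F0 # blocks w\<close> and
  \<open>F1 # F0 # blocks w\<close> act in the same way; the canonical word is the one with \<open>F1\<close>.\<close>

fun normal :: "bool list \<Rightarrow> bool" where
  "normal [] = True"
| "normal (a # w) = (normal w \<and> (a \<longrightarrow> (\<exists>x. \<not> first_out w x)))"

lemma act_mark_0: "act (mark a) s 0 = (\<not> a \<and> s 0)"
  by (simp add: mark_def)

lemma act_mark_Suc: "act (mark a) s (Suc i) = (s (Suc i) \<and> \<not> s i)"
  by (simp add: mark_def)

text \<open>On an image of \<open>F1\<close> or \<open>F2\<close>, which has no two adjacent letters \<open>X1\<close>, the product of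
  \<open>F1\<close> or \<open>F2\<close> with \<open>F0\<close> is a shift.\<close>

lemma act_word_blocks:
  assumes "w \<noteq> []"
  shows "act_word (blocks w) s i =
    (if i < length w then first_out (drop i w) (s 0)
     else s (i - length w) \<and> \<not> s (Suc i - length w))"
  using assms
proof (induction w arbitrary: i)
  case (Cons a w)
  show ?case
  proof (cases "w = []")
    case True
    then show ?thesis by (cases i) (auto simp: act_mark_0 act_mark_Suc)
  next
    case False
    let ?y = "act_word (blocks w) s"
    obtain b v where "w = b # v" using False by (cases w) auto
    then have "\<not> (?y (Suc j) \<and> ?y j)" for j
      by (cases j) (auto simp: act_mark_0 act_mark_Suc)
    then have "act_word (blocks (a # w)) s (Suc j) = ?y j" for j
      by (auto simp: act_mark_Suc)
    moreover have "act_word (blocks (a # w)) s 0 = first_out (a # w) (s 0)"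
      using Cons.IH[OF False, of 0] False by (simp add: act_mark_0)
    ultimately show ?thesis
      using Cons.IH[OF False] by (cases i) (auto simp del: blocks_simps)
  qed
qed simp

type_synonym code = "bool \<times> bool list \<times> bool"

text \<open>In \<open>(p, w, q)\<close> the flags \<open>p\<close> and \<open>q\<close> stand for a leading and a trailing \<open>F0\<close>. The words \<open>[]\<close>
  and \<open>[F0]\<close> have \<open>w = []\<close> and, by convention, \<open>q = True\<close>.\<close>

fun valid :: "code \<Rightarrow> bool" where
  "valid (p, w, q) = (normal w \<and> (w = [] \<longrightarrow> q))"

fun code_word :: "code \<Rightarrow> state list" where
  "code_word (p, w, q) =
    (if p then [F0] else []) @ (if q then blocks w else butlast (blocks w))"

text \<open>Dropping the trailing \<open>F0\<close> costs one letter. The convention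
  \<open>q = True\<close> for empty \<open>w\<close> makes the formula cover \<open>[]\<close> and
  \<open>[F0]\<close>.\<close>

lemma length_code_word:
  assumes "valid (p, w, q)"
  shows "Suc (length (code_word (p, w, q))) = 2 * length w + of_bool p + of_bool q"
  using assms by (cases w) auto

lemma butlast_blocks: "w \<noteq> [] \<Longrightarrow> butlast (blocks w) @ [F0] = blocks w"
proof (induction w)
  case (Cons a w)
  then show ?case by (cases "w = []") auto
qed simp

lemma act_F0: "act F0 s = (\<lambda>i. \<not> s i)"
  by auto

text \<open>A missing trailing \<open>F0\<close> is made up for by complementing the argument, as
  \<open>F0\<close> is an involution; hence the comparison \<open>s i = q\<close>.\<close>

lemma act_word_code_word:
  assumes "valid (p, w, q)"
  shows "act_word (code_word (p, w, q)) s i = (p \<noteq> act_word (blocks w) (\<lambda>i. s i = q) i)"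
proof -
  have "act_word (butlast (blocks w)) s = act_word (blocks w) (\<lambda>i. \<not> s i)" if "w \<noteq> []"
  proof -
    have "act_word (blocks w) (\<lambda>i. \<not> s i) =
        act_word (butlast (blocks w) @ [F0]) (\<lambda>i. \<not> s i)"
      using butlast_blocks[OF that] by simp
    then show ?thesis by (simp add: act_F0)
  qed
  then show ?thesis
    using assms by (cases q) auto
qed

text \<open>Once the tails agree, the head is visible in \<open>first_out\<close> at any
  \<open>x\<close> where the tail yields \<open>False\<close>; if there is none, normality forces
  the head to be \<open>False\<close>.\<close>

lemma normal_unique:
  assumes "length w = length w'" "normal w" "normal w'"
    and "\<And>i. i < length w \<Longrightarrow> first_out (drop i w) = first_out (drop i w')"
  shows "w = w'"
  using assms
proof (induction w w' rule: list_induct2)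
  case (Cons a w b w')
  have "w = w'"
  proof (rule Cons.IH)
    show "first_out (drop i w) = first_out (drop i w')" if "i < length w" for i
      using Cons.prems(3)[of "Suc i"] that by simp
  qed (use Cons.prems in auto)
  moreover have "first_out (a # w) x = first_out (b # w') x" for x
    using fun_cong[OF Cons.prems(3)[of 0], of x] by simp
  ultimately show ?case
    using Cons.prems(1,2) by (cases a; cases b) auto
qed simp

text \<open>Far from the start, \<open>code_word (p, w, q)\<close> acts as a shift by \<open>length w\<close> followed by the
  detection of a change of letter from \<open>q\<close> to \<open>\<not> q\<close> and by negation if \<open>p\<close> holds. This determines
  \<open>p\<close>, \<open>q\<close> and the length of \<open>w\<close>.\<close>

lemma code_word_inj:
  assumes v: "valid (p, w, q)" "valid (p', w', q')"
    and eq: "act_word (code_word (p, w, q)) = act_word (code_word (p', w', q'))"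
  shows "(p, w, q) = (p', w', q')"
proof -
  let ?m = "length w" and ?m' = "length w'"
  have E: "(p \<noteq> act_word (blocks w) (\<lambda>i. s i = q) i) =
      (p' \<noteq> act_word (blocks w') (\<lambda>i. s i = q') i)" for s i
    using fun_cong[OF fun_cong[OF eq], of s i] act_word_code_word[OF v(1)]
      act_word_code_word[OF v(2)] by simp
  \<comment> \<open>A constant stream has no change of letter to detect, and the position lies past
    both prefixes.\<close>
  have const: "act_word (blocks w) (\<lambda>i. b) (?m + ?m') \<longleftrightarrow> w = [] \<and> b"
    "act_word (blocks w') (\<lambda>i. b) (?m + ?m') \<longleftrightarrow> w' = [] \<and> b" for b
    by (cases "w = []"; simp add: act_word_blocks)
      (cases "w' = []"; simp add: act_word_blocks)
  have p: "(p \<noteq> (w = [] \<and> b = q)) = (p' \<noteq> (w' = [] \<and> b = q'))" for b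
    using E[of "\<lambda>_. b" "?m + ?m'"] const by simp
  have nil: "w = [] \<longleftrightarrow> w' = []"
    using p[of True] p[of False] by auto
  show ?thesis
  proof (cases "w = []")
    case True
    then show ?thesis using nil v p[of True] by simp
  next
    case False
    then have ne: "w \<noteq> []" "w' \<noteq> []" using nil by auto
    then have pp: "p = p'" using p[of True] by simp
    \<comment> \<open>The test streams change their letter only at \<open>?K\<close>, late enough
      for the detected position to lie past both prefixes.\<close>
    let ?K = "Suc (?m + ?m')"
    have jump: "act_word (blocks w) (\<lambda>j. (b = (?K \<le> j)) = c) i \<longleftrightarrow> i = ?m + ?m' + ?m \<and> b \<noteq> c"
      "act_word (blocks w') (\<lambda>j. (b = (?K \<le> j)) = c) i \<longleftrightarrow> i = ?m + ?m' + ?m' \<and> b \<noteq> c"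
      if "i \<ge> ?m" "i \<ge> ?m'" for b c i
      using ne that by (auto simp: act_word_blocks)
    have J: "(i = ?m + ?m' + ?m \<and> b \<noteq> q) = (i = ?m + ?m' + ?m' \<and> b \<noteq> q')"
      if "i \<ge> ?m" "i \<ge> ?m'" for b i
      using E[of "\<lambda>j. b = (?K \<le> j)" i] unfolding pp jump[OF that] by blast
    have qq: "q = q'" using J[of "?m + ?m' + ?m" "\<not> q"] by auto
    have len: "?m = ?m'" using J[of "?m + ?m' + ?m" "\<not> q"] by auto
    have "w = w'"
    proof (rule normal_unique[OF len])
      show "first_out (drop i w) = first_out (drop i w')" if "i < ?m" for i
      proof
        fix x
        show "first_out (drop i w) x = first_out (drop i w') x"
          \<comment> \<open>Comparing the constant letter \<open>x = q\<close> with \<open>q\<close>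
            gives back \<open>x\<close>.\<close>
          using E[of "\<lambda>_. x = q" i] that pp qq len ne
          by (cases p'; cases q') (auto simp: act_word_blocks)
      qed
    qed (use v in auto)
    then show ?thesis using pp qq by simp
  qed
qed

section \<open>Reduction to canonical words\<close>

text \<open>Each leading \<open>False\<close> negates, a \<open>True\<close> produces the constant
  \<open>False\<close>, and without any \<open>True\<close> the result depends on
  \<open>x\<close>.\<close>

lemma first_out_const_True:
  assumes "\<And>x. first_out w x"
  shows "\<exists>j v. w = replicate (Suc (2 * j)) False @ True # v"
  using assms
proof (induction w rule: induct_list012)
  case 1
  then show ?case by auto
next
  case (2 a)
  then show ?case by (metis first_out.simps)
next
  case (3 a b w)
  have a: "\<not> a" using 3(3) by auto
  show ?case
  proof (cases b)
    case True
    then show ?thesis using a by (intro exI[of _ 0] exI[of _ w]) simp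
  next
    case False
    then have "first_out w x" for x using 3(3)[of x] by auto
    then obtain j v where "w = replicate (Suc (2 * j)) False @ True # v"
      using 3(1) by blast
    then show ?thesis
      using a False by (intro exI[of _ "Suc j"] exI[of _ v]) simp
  qed
qed

text \<open>The relation of length five is the case \<open>j = 0\<close>. In the step, the induction
  hypothesis turns the third mark into \<open>F2\<close>, the relation then changes the first mark,
  and the third is turned back.\<close>

lemma odd_gap:
  "F2 # F0 # blocks (replicate (Suc (2 * j)) False) @ [F2] \<approx>
   F1 # F0 # blocks (replicate (Suc (2 * j)) False) @ [F2]"
proof (induction j)
  case 0
  show ?case by (simp add: mark_def A6_relations_def congruence_generated.base)
next
  case (Suc j)
  let ?z = "blocks (replicate (Suc (2 * j)) False)"
  have rel: "[F2, F0, F1, F0, F2] \<approx> [F1, F0, F1, F0, F2]"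
    by (simp add: A6_relations_def congruence_generated.base)
  have "[F2, F0, F1, F0] @ (F1 # F0 # ?z @ [F2]) @ [] \<approx>
      [F2, F0, F1, F0] @ (F2 # F0 # ?z @ [F2]) @ []"
    by (rule equivalent_context[OF congruence_generated.sym[OF Suc.IH]])
  also have "\<dots> = [] @ [F2, F0, F1, F0, F2] @ (F0 # ?z @ [F2])" by simp
  also have "\<dots> \<approx> [] @ [F1, F0, F1, F0, F2] @ (F0 # ?z @ [F2])"
    by (rule equivalent_context[OF rel])
  also have "\<dots> = [F1, F0, F1, F0] @ (F2 # F0 # ?z @ [F2]) @ []" by simp
  also have "\<dots> \<approx> [F1, F0, F1, F0] @ (F1 # F0 # ?z @ [F2]) @ []"
    by (rule equivalent_context[OF Suc.IH])
  finally show ?case by (simp add: mark_def)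
qed

text \<open>Normality can fail only if \<open>a\<close> holds and the next \<open>F2\<close> follows
  after an odd number of \<open>F1\<close>; then \<open>odd_gap\<close> replaces the head.\<close>

lemma normalize_first:
  assumes "normal w"
  shows "\<exists>b. normal (b # w) \<and> code_word (False, a # w, q) \<approx> code_word (False, b # w, q)"
proof (cases "normal (a # w)")
  case True
  then show ?thesis using congruence_generated.refl by blast
next
  case False
  then have a: "a" and "\<And>x. first_out w x" using assms by auto
  then obtain j v where w: "w = replicate (Suc (2 * j)) False @ True # v"
    using first_out_const_True by blast
  let ?z = "F0 # blocks (replicate (Suc (2 * j)) False) @ [F2]"
  let ?r = "if q then F0 # blocks v else butlast (F0 # blocks v)"
  have "code_word (False, b # w, q) = [] @ (mark b # ?z) @ ?r" for b
    by (simp add: w mark_def butlast_append)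
  moreover have "[] @ (mark True # ?z) @ ?r \<approx> [] @ (mark False # ?z) @ ?r"
    using equivalent_context[OF odd_gap, of "[]" j ?r] by (simp add: mark_def)
  ultimately show ?thesis
    using a assms by (intro exI[of _ False]) simp
qed

text \<open>\<open>F0\<close> toggles \<open>p\<close>; a mark opens a new block before
  \<open>F0\<close> or the empty word and otherwise merges with the first mark. The last conjunct
  tracks parity for elements expressed by \<open>F0\<close> alone.\<close>

lemma reduce_Cons:
  assumes v: "valid (p, w, q)"
  shows "\<exists>p' w' q'. valid (p', w', q') \<and> x # code_word (p, w, q) \<approx> code_word (p', w', q')
    \<and> length (code_word (p', w', q')) \<le> Suc (length (code_word (p, w, q)))
    \<and> (w' = [] \<longrightarrow> w = [] \<and> p' = (\<not> p))"
proof (cases "x = F0")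
  case True
  have "[F0, F0] \<approx> []"
    by (simp add: A6_relations_def congruence_generated.base)
  then have "x # code_word (p, w, q) \<approx> code_word (\<not> p, w, q)"
    using equivalent_context[of "[F0, F0]" "[]" "[]" "code_word (False, w, q)"] True
    by (cases p) (simp_all add: congruence_generated.refl)
  then show ?thesis
    using v by (intro exI[of _ "\<not> p"] exI[of _ w] exI[of _ q]) auto
next
  case False
  then obtain a where x: "x = mark a"
    by (metis (full_types) mark_def state.exhaust)
  \<comment> \<open>It suffices to reach a word with normal tail, since repairing its head preserves
    the length.\<close>
  have goal: ?thesis
    if n: "normal u" and "x # code_word (p, w, q) \<approx> code_word (False, c # u, r)"
      "length (code_word (False, c # u, r)) \<le> Suc (length (code_word (p, w, q)))" for c u r
  proof -
    obtain b where b: "normal (b # u)" "code_word (False, c # u, r) \<approx> code_word (False, b # u, r)"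
      using normalize_first[OF n(1)] by blast
    have "length (code_word (False, b # u, r)) = length (code_word (False, c # u, r))"
      by simp
    then show ?thesis
      using b that congruence_generated.trans
      by (intro exI[of _ False] exI[of _ "b # u"] exI[of _ r]) (auto simp del: code_word.simps)
  qed
  show ?thesis
  proof (cases p)
    case True
    have eq: "x # code_word (p, w, q) = code_word (False, a # w, q)"
      using True v by (auto simp: x)
    show ?thesis
    proof (rule goal)
      show "x # code_word (p, w, q) \<approx> code_word (False, a # w, q)"
        unfolding eq by (rule congruence_generated.refl)
    qed (use v in \<open>auto simp flip: eq simp del: code_word.simps\<close>)
  next
    case p: False
    show ?thesis
    proof (cases w)
      case Nil
      have eq: "x # code_word (p, w, q) = code_word (False, [a], False)"
        using p Nil v by (simp add: x)
      show ?thesis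
      proof (rule goal)
        show "x # code_word (p, w, q) \<approx> code_word (False, [a], False)"
          unfolding eq by (rule congruence_generated.refl)
      qed (auto simp flip: eq simp del: code_word.simps)
    next
      case (Cons b u)
      \<comment> \<open>\<open>F2\<close> absorbs \<open>F1\<close> on both sides, and both are
        idempotent.\<close>
      have ab: "[mark a, mark b] \<approx> [mark (a \<or> b)]"
        by (cases a; cases b) (simp_all add: mark_def A6_relations_def congruence_generated.base)
      define r where "r = (if q then F0 # blocks u else butlast (F0 # blocks u))"
      have word: "code_word (False, d # u, q) = [mark d] @ r" for d
        by (simp add: r_def)
      show ?thesis
      proof (rule goal)
        show "x # code_word (p, w, q) \<approx> code_word (False, (a \<or> b) # u, q)"
          using equivalent_context[OF ab, of "[]" r] p Cons word
          by (simp add: x del: code_word.simps)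
      qed (use v p Cons in auto)
    qed
  qed
qed

lemma reduce:
  "\<exists>p w q. valid (p, w, q) \<and> u \<approx> code_word (p, w, q)
    \<and> length (code_word (p, w, q)) \<le> length u \<and> (w = [] \<longrightarrow> p = odd (length u))"
proof (induction u)
  case Nil
  show ?case
    by (intro exI[of _ False] exI[of _ "[]"] exI[of _ True])
      (simp add: congruence_generated.refl)
next
  case (Cons x u)
  then obtain p w q where IH: "valid (p, w, q)" "u \<approx> code_word (p, w, q)"
    "length (code_word (p, w, q)) \<le> length u" "w = [] \<longrightarrow> p = odd (length u)" by blast
  obtain p' w' q' where 1: "valid (p', w', q')" "x # code_word (p, w, q) \<approx> code_word (p', w', q')"
    "length (code_word (p', w', q')) \<le> Suc (length (code_word (p, w, q)))"
    "w' = [] \<longrightarrow> w = [] \<and> p' = (\<not> p)"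
    using reduce_Cons[OF IH(1)] by blast
  have "x # u \<approx> x # code_word (p, w, q)"
    using equivalent_context[OF IH(2), of "[x]" "[]"] by simp
  then have "x # u \<approx> code_word (p', w', q')"
    using 1(2) by (rule congruence_generated.trans)
  then show ?case
    using 1 IH by (intro exI[of _ p'] exI[of _ w'] exI[of _ q']) (auto simp del: code_word.simps)
qed

text \<open>Completeness of the relations: both words reduce to canonical ones, which coincide if
  the actions do.\<close>

lemma equivalent_iff: "u \<approx> v \<longleftrightarrow> generator_product A6 u = generator_product A6 v"
proof
  assume "u \<approx> v"
  then show "generator_product A6 u = generator_product A6 v"
    by (simp add: generator_product_eq_iff act_word_equivalent)
next
  assume "generator_product A6 u = generator_product A6 v"
  then have eq: "act_word u = act_word v" by (simp add: generator_product_eq_iff)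
  obtain p w q where 1: "valid (p, w, q)" "u \<approx> code_word (p, w, q)"
    using reduce[of u] by blast
  obtain p' w' q' where 2: "valid (p', w', q')" "v \<approx> code_word (p', w', q')"
    using reduce[of v] by blast
  have "(p, w, q) = (p', w', q')"
    using code_word_inj[OF 1(1) 2(1)] eq 1(2) 2(2) by (metis act_word_equivalent)
  then show "u \<approx> v"
    using 1(2) 2(2) by (metis congruence_generated.sym congruence_generated.trans)
qed

lemma states_A6 [simp]: "states A6 = UNIV"
  by (simp add: A6_def)

lemma automaton_semigroup_A6: "automaton_semigroup A6 = range (generator_product A6)"
proof
  show "automaton_semigroup A6 \<subseteq> range (generator_product A6)"
  proof
    fix s assume "s \<in> automaton_semigroup A6"
    then show "s \<in> range (generator_product A6)"
    proof (induction rule: automaton_semigroup.induct)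
      case (generator q)
      have "transformation A6 q = generator_product A6 [q]" by simp
      then show ?case by blast
    next
      case (product s t)
      then obtain u v where "s = generator_product A6 u" "t = generator_product A6 v"
        by blast
      then have "s \<circ> t = generator_product A6 (u @ v)"
        by (simp only: generator_product_append)
      then show ?case by blast
    qed
  qed
next
  \<comment> \<open>The semigroup contains the empty product because \<open>F0\<close> is an
    involution.\<close>
  have F0: "transformation A6 F0 \<circ> transformation A6 F0 = id"
    using equivalent_iff[of "[F0, F0]" "[]"]
    by (simp add: A6_relations_def congruence_generated.base)
  have gen: "transformation A6 q \<in> automaton_semigroup A6" for q
    by (simp add: automaton_semigroup.generator)
  have "generator_product A6 u \<in> automaton_semigroup A6" for u
  proof (induction u)
    case Nil
    show ?case
      using automaton_semigroup.product[OF gen[of F0] gen[of F0]] unfolding F0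
      by (simp add: id_def)
  next
    case (Cons q u)
    then show ?case
      using automaton_semigroup.product[OF gen] by (simp add: comp_def)
  qed
  then show "range (generator_product A6) \<subseteq> automaton_semigroup A6" by blast
qed

lemma presentation_A6:
  "has_presentation (automaton_monoid A6) (transformation A6) A6_relations"
proof -
  have "monoid (automaton_monoid A6)"
  proof (rule monoidI)
    have "generator_product A6 [] \<in> automaton_semigroup A6"
      unfolding automaton_semigroup_A6 by blast
    then show "\<one>\<^bsub>automaton_monoid A6\<^esub> \<in> carrier (automaton_monoid A6)"
      by (simp add: automaton_monoid_def)
  qed (auto simp: automaton_monoid_def comp_assoc intro: automaton_semigroup.product)
  then have "has_presentation (automaton_monoid A6) (\<lambda>x. generator_product A6 [x]) A6_relations"
    by (rule has_presentationI)
      (simp_all only: equivalent_iff generator_product_append,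
       simp_all add: automaton_monoid_def automaton_semigroup_A6 comp_def)
  then show ?thesis by simp
qed

section \<open>Growth\<close>

definition code_map :: "code \<Rightarrow> letter list \<Rightarrow> letter list" where
  "code_map t = generator_product A6 (code_word t)"

definition code_length :: "code \<Rightarrow> nat" where
  "code_length t = length (code_word t)"

lemma inj_code_map: "inj_on code_map {t. valid t}"
  unfolding inj_on_def code_map_def generator_product_eq_iff
  using code_word_inj by (metis mem_Collect_eq prod_cases3)

lemma reduce_code:
  "\<exists>t. valid t \<and> generator_product A6 u = code_map t \<and> code_length t \<le> length u
    \<and> (fst (snd t) = [] \<longrightarrow> fst t = odd (length u))"
  using reduce[of u] unfolding code_map_def code_length_def equivalent_iff
  by (metis fst_conv snd_conv)

text \<open>Reduction never lengthens a word and ends in the unique code of its element, so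
  canonical words are shortest.\<close>

lemma element_length_code_map:
  assumes "valid t"
  shows "element_length A6 (code_map t) = code_length t"
  unfolding element_length_def
proof (rule Least_equality)
  show "\<exists>qs. set qs \<subseteq> states A6 \<and> length qs = code_length t \<and> generator_product A6 qs = code_map t"
    by (auto simp: code_length_def code_map_def)
next
  fix n
  assume "\<exists>qs. set qs \<subseteq> states A6 \<and> length qs = n \<and> generator_product A6 qs = code_map t"
  then obtain qs where qs: "length qs = n" "generator_product A6 qs = code_map t" by blast
  obtain t' where "valid t'" "generator_product A6 qs = code_map t'" "code_length t' \<le> n"
    using reduce_code[of qs] qs by blast
  then show "code_length t \<le> n"
    using inj_code_map assms qs by (metis inj_onD mem_Collect_eq)
qed

definition codes :: "nat \<Rightarrow> code set" where
  "codes n = {t. valid t \<and> code_length t = n}"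

definition codes_upto :: "nat \<Rightarrow> code set" where
  "codes_upto n = {t. valid t \<and> code_length t \<le> n}"

lemma semigroup_growth_A6: "semigroup_growth A6 n = card (codes_upto n)"
proof -
  have "{s \<in> automaton_semigroup A6. element_length A6 s \<le> n} = code_map ` codes_upto n"
  proof (intro equalityI subsetI)
    fix s assume "s \<in> {s \<in> automaton_semigroup A6. element_length A6 s \<le> n}"
    then obtain u where u: "s = generator_product A6 u" "element_length A6 s \<le> n"
      by (auto simp: automaton_semigroup_A6)
    obtain t where "valid t" "s = code_map t"
      using reduce_code[of u] u by blast
    then show "s \<in> code_map ` codes_upto n"
      using u element_length_code_map by (auto simp: codes_upto_def)
  next
    fix s assume "s \<in> code_map ` codes_upto n"
    then show "s \<in> {s \<in> automaton_semigroup A6. element_length A6 s \<le> n}"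
      using element_length_code_map
      by (auto simp: codes_upto_def automaton_semigroup_A6 code_map_def)
  qed
  moreover have "inj_on code_map (codes_upto n)"
    by (rule inj_on_subset[OF inj_code_map]) (auto simp: codes_upto_def)
  ultimately show ?thesis
    by (simp add: semigroup_growth_def card_image)
qed

lemma replicate_F0: "generator_product A6 (replicate n F0) = code_map (odd n, [], True)"
proof -
  have "act_word (replicate n F0) s i = (s i \<noteq> odd n)" for s i
    by (induction n) auto
  then show ?thesis
    unfolding code_map_def generator_product_eq_iff by (auto simp: fun_eq_iff)
qed

lemma act_mark_idem: "act (mark a) (act (mark a) s) = act (mark a) s"
proof
  have "act (mark a) s j \<Longrightarrow> s j" for j
    by (cases j) (auto simp: act_mark_0 act_mark_Suc)
  then show "act (mark a) (act (mark a) s) i = act (mark a) s i" for i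
    by (cases i) (auto simp: act_mark_0 act_mark_Suc)
qed

text \<open>Repeating the idempotent first mark lengthens the word without changing the
  element.\<close>

lemma pad_code_map:
  assumes "valid (p, w, q)" "w \<noteq> []" "code_length (p, w, q) \<le> n"
  shows "\<exists>u. length u = n \<and> generator_product A6 u = code_map (p, w, q)"
proof -
  obtain b v where w: "w = b # v" using assms(2) by (cases w) auto
  define l where "l = (if p then [F0] else [])"
  define r where "r = (if q then F0 # blocks v else butlast (F0 # blocks v))"
  define k where "k = n - code_length (p, w, q)"
  have word: "code_word (p, w, q) = l @ mark b # r"
    by (simp add: w l_def r_def)
  have "act_word (replicate k (mark b)) (act (mark b) s) = act (mark b) s" for s
    by (induction k) (simp_all add: act_mark_idem)
  then have "generator_product A6 (l @ replicate k (mark b) @ mark b # r) = code_map (p, w, q)"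
    unfolding code_map_def generator_product_eq_iff word by (intro ext) simp
  moreover have "length (l @ replicate k (mark b) @ mark b # r) = n"
    using assms(3) word by (simp add: k_def code_length_def del: code_word.simps)
  ultimately show ?thesis by blast
qed

lemma mealy_automaton_A6: "mealy_automaton A6"
proof -
  have "UNIV = {F0, F1, F2}"
    by (metis (full_types) UNIV_eq_I insertCI state.exhaust)
  then have "finite (UNIV :: state set)" by (metis finite.simps)
  then show ?thesis by (simp add: mealy_automaton_def)
qed

lemma products_A6:
  assumes "n > 0"
  shows "generator_product A6 ` {qs. length qs = n} =
    code_map ` (codes_upto n - {(even n, [], True)})"
proof (intro equalityI subsetI)
  fix s assume "s \<in> generator_product A6 ` {qs. length qs = n}"
  then obtain u where u: "length u = n" "s = generator_product A6 u" by auto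
  obtain t where "valid t" "s = code_map t" "code_length t \<le> n"
    "fst (snd t) = [] \<longrightarrow> fst t = odd n"
    using reduce_code[of u] u by blast
  then show "s \<in> code_map ` (codes_upto n - {(even n, [], True)})"
    by (auto simp: codes_upto_def)
next
  fix s assume "s \<in> code_map ` (codes_upto n - {(even n, [], True)})"
  then obtain t where "t \<in> codes_upto n" "t \<noteq> (even n, [], True)" "s = code_map t"
    by blast
  moreover obtain p w q where "t = (p, w, q)" by (cases t)
  ultimately have t: "valid (p, w, q)" "code_length (p, w, q) \<le> n"
    "(p, w, q) \<noteq> (even n, [], True)" "s = code_map (p, w, q)"
    by (auto simp: codes_upto_def)
  show "s \<in> generator_product A6 ` {qs. length qs = n}"
  proof (cases "w = []")
    case True
    then have "s = generator_product A6 (replicate n F0)"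
      using t by (auto simp: replicate_F0)
    then show ?thesis by simp
  next
    case False
    then obtain u where "length u = n" "generator_product A6 u = s"
      using pad_code_map[OF t(1) False t(2)] t(4) by auto
    then show ?thesis by blast
  qed
qed

section \<open>Counting canonical words\<close>

lemma finite_bool_lists: "finite {w :: bool list. length w = m}"
  using finite_lists_length_eq[of "UNIV :: bool set" m] by simp

definition normals :: "nat \<Rightarrow> bool list set" where
  "normals m = {w. normal w \<and> length w = m}"

lemma finite_normals: "finite (normals m)"
  by (rule finite_subset[OF _ finite_bool_lists[of m]]) (auto simp: normals_def)

lemma normals_Suc:
  "normals (Suc m) = Cons False ` normals m \<union> Cons True ` {w \<in> normals m. \<exists>x. \<not> first_out w x}"
  unfolding normals_def by (auto simp: length_Suc_conv image_iff)

text \<open>Normal lists are sorted by \<open>first_out\<close>: constantly \<open>True\<close>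
  (\<open>A\<close>), constantly \<open>False\<close> (\<open>B\<close>), nonconstant
  (\<open>C\<close>). Prefixing \<open>False\<close> exchanges \<open>A\<close> and \<open>B\<close>
  and preserves \<open>C\<close>; prefixing \<open>True\<close> is allowed on \<open>B\<close> and
  \<open>C\<close> and leads to \<open>B\<close>.\<close>

lemma card_normals: "card (normals m) + 1 = fib (m + 3)"
proof -
  define A where "A m = {w \<in> normals m. first_out w True \<and> first_out w False}" for m
  define B where "B m = {w \<in> normals m. \<not> first_out w True \<and> \<not> first_out w False}" for m
  define C where "C m = {w \<in> normals m. first_out w True \<noteq> first_out w False}" for m
  have N: "normals (Suc m) = Cons False ` normals m \<union> Cons True ` (B m \<union> C m)" for m
    unfolding normals_Suc B_def C_def by (auto simp: ex_bool_eq)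
  have A: "A (Suc m) = Cons False ` B m" for m
    by (auto simp: A_def B_def C_def N)
  have B: "B (Suc m) = Cons False ` A m \<union> Cons True ` (B m \<union> C m)" for m
    by (auto simp: A_def B_def C_def N)
  have C: "C (Suc m) = Cons False ` C m" for m
    by (auto simp: A_def B_def C_def N)
  have fin: "finite (A m)" "finite (B m)" "finite (C m)" for m
    using finite_normals by (simp_all add: A_def B_def C_def)
  have BC: "card (B m \<union> C m) = card (B m) + card (C m)" for m
    using fin by (intro card_Un_disjoint) (auto simp: B_def C_def)
  have cards: "card (A (Suc m)) = card (B m)" "card (C (Suc m)) = card (C m)"
    "card (B (Suc m)) = card (A m) + (card (B m) + card (C m))" for m
    unfolding A B C using fin[of m]
    by (simp_all add: card_image, subst card_Un_disjoint)
      (auto simp: card_image BC simp del: image_Un)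
  \<comment> \<open>As \<open>C m\<close> is a singleton, adding 1 to the other counts turns their
    recursion into the Fibonacci one.\<close>
  have "card (A m) + 1 = fib (m + 1) \<and> card (B m) + 1 = fib (m + 2) \<and> card (C m) = 1"
  proof (induction m)
    case 0
    have "A 0 = {}" "B 0 = {}" "C 0 = {[]}"
      by (auto simp: A_def B_def C_def normals_def)
    then show ?case by (simp add: numeral_2_eq_2)
  next
    case (Suc m)
    then show ?case by (simp add: cards)
  qed
  moreover have "normals m = A m \<union> (B m \<union> C m)"
    by (auto simp: A_def B_def C_def)
  moreover have "card (A m \<union> (B m \<union> C m)) = card (A m) + card (B m \<union> C m)"
    using fin by (intro card_Un_disjoint) (auto simp: A_def B_def C_def)
  ultimately show ?thesis
    by (simp add: BC numeral_3_eq_3)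
qed

lemma codes_alt:
  "(p, w, q) \<in> codes n \<longleftrightarrow> normal w \<and> (w = [] \<longrightarrow> q) \<and> Suc n = 2 * length w + of_bool p + of_bool q"
  using length_code_word[of p w q] by (auto simp: codes_def code_length_def simp del: code_word.simps)

lemma codes_0: "codes 0 = {(False, [], True)}"
proof -
  have "(p, w, q) \<in> codes 0 \<longleftrightarrow> (p, w, q) = (False, [], True)" for p w q
    unfolding codes_alt by (cases w) (auto split: if_splits)
  then show ?thesis by auto
qed

text \<open>By the length formula, \<open>p\<close> and the parity of \<open>n\<close> determine
  \<open>q\<close> and the length of \<open>w\<close>. For positive \<open>n\<close> the excluded
  case of empty \<open>w\<close> with \<open>q\<close> false does not arise.\<close>

lemma card_codes:
  assumes "n > 0"
  shows "card (codes n) = card (normals (n div 2)) + card (normals (Suc n div 2))"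
proof -
  let ?I = "\<lambda>p q. (\<lambda>w. (p, w, q)) :: bool list \<Rightarrow> code"
  have "t \<in> codes n \<longleftrightarrow>
      t \<in> ?I True (odd n) ` normals (n div 2) \<union> ?I False (even n) ` normals (Suc n div 2)" for t
  proof (cases t)
    case (fields p w q)
    show ?thesis
      using assms unfolding fields codes_alt normals_def
      by (cases p; cases q) (auto simp: image_iff elim!: evenE oddE, presburger+)
  qed
  then have eq: "codes n =
      ?I True (odd n) ` normals (n div 2) \<union> ?I False (even n) ` normals (Suc n div 2)"
    by blast
  show ?thesis
    unfolding eq using finite_normals
    by (subst card_Un_disjoint) (auto simp: card_image inj_on_def)
qed

lemma finite_codes: "finite (codes n)"
proof (rule finite_subset)
  show "codes n \<subseteq> (UNIV :: bool set) \<times> {w. set w \<subseteq> UNIV \<and> length w \<le> Suc n} \<times> UNIV"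
    using codes_alt by fastforce
  show "finite ((UNIV :: bool set) \<times>
      {w :: bool list. set w \<subseteq> UNIV \<and> length w \<le> Suc n} \<times> (UNIV :: bool set))"
    using finite_lists_length_le[of "UNIV :: bool set"] by (intro finite_cartesian_product) auto
qed

lemma codes_upto_eq: "codes_upto n = (\<Union>k\<le>n. codes k)"
  by (auto simp: codes_upto_def codes_def)

lemma finite_codes_upto: "finite (codes_upto n)"
  by (simp add: codes_upto_eq finite_codes)

lemma card_codes_upto_Suc: "card (codes_upto (Suc n)) = card (codes_upto n) + card (codes (Suc n))"
proof -
  have "codes_upto (Suc n) = codes_upto n \<union> codes (Suc n)"
    by (auto simp: codes_upto_def codes_def)
  then show ?thesis
    using finite_codes_upto finite_codes
    by (simp add: card_Un_disjoint codes_upto_def codes_def disjoint_iff)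
qed

lemma card_codes_upto_0: "card (codes_upto 0) = 1"
  by (simp add: codes_upto_eq codes_0)

lemma automaton_growth_A6:
  assumes "n > 0"
  shows "automaton_growth A6 n + 1 = semigroup_growth A6 n"
proof -
  let ?S = "codes_upto n - {(even n, [], True)}"
  have "automaton_growth A6 n = card (code_map ` ?S)"
    using automaton_growth_eq_card[OF mealy_automaton_A6 assms] products_A6[OF assms] by simp
  also have "\<dots> = card ?S"
    by (rule card_image[OF inj_on_subset[OF inj_code_map]]) (auto simp: codes_upto_def)
  finally have "automaton_growth A6 n = card ?S" .
  moreover have "(even n, [], True) \<in> codes_upto n"
    using assms by (simp add: codes_upto_def code_length_def)
  ultimately show ?thesis
    using card_Suc_Diff1[OF finite_codes_upto] semigroup_growth_A6 by simp
qed

lemma semigroup_growth_A6_0: "semigroup_growth A6 0 = 1"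
  by (simp add: semigroup_growth_A6 card_codes_upto_0)

lemma semigroup_growth_A6_1: "semigroup_growth A6 1 = 4"
  using card_codes_upto_Suc[of 0] card_codes[of 1] card_normals[of 0] card_normals[of 1]
  by (simp add: semigroup_growth_A6 card_codes_upto_0 numeral_eq_Suc)

lemma card_normals_Suc: "card (normals (Suc m)) = card (normals m) + fib (m + 2)"
  using card_normals[of m] card_normals[of "Suc m"] by (simp add: numeral_eq_Suc)

text \<open>A second difference, written without subtraction: the counts for consecutive lengths
  share a summand in \<open>card_codes\<close>, and their other summands concern normal lists one
  letter apart.\<close>

lemma semigroup_growth_A6_rec:
  "semigroup_growth A6 (n + 2) + semigroup_growth A6 n =
    2 * semigroup_growth A6 (n + 1) + fib ((n + 3) div 2 + 1)"
proof -
  have "card (codes (n + 2)) = card (codes (n + 1)) + fib ((n + 3) div 2 + 1)"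
  proof -
    have div: "(n + 3) div 2 = Suc (Suc n div 2)" by simp
    show ?thesis
      unfolding div card_codes[of "n + 2", simplified] using card_normals_Suc[of "Suc n div 2"]
      by (simp add: card_codes)
  qed
  then show ?thesis
    using card_codes_upto_Suc[of n] card_codes_upto_Suc[of "n + 1"]
    by (simp add: semigroup_growth_A6)
qed

section \<open>Generating functions\<close>

lemma fps_fib_halved:
  "Abs_fps (\<lambda>n. of_nat (fib (Suc n div 2 + 1))) * (1 - fps_X^2 - fps_X^4) =
    (1 + fps_X + fps_X^3 :: rat fps)" (is "?F * _ = ?R")
proof (rule fps_ext)
  fix n :: nat
  define f where "f n = (of_nat (fib (Suc n div 2 + 1)) :: rat)" for n
  have L: "fps_nth (?F * (1 - fps_X^2 - fps_X^4)) n =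
      f n - (if n < 2 then 0 else f (n - 2)) - (if n < 4 then 0 else f (n - 4))"
    by (simp add: right_diff_distrib fps_X_power_mult_right_nth f_def)
  have "fib 2 = 1" "fib 3 = 2"
    by (simp_all add: numeral_2_eq_2 numeral_3_eq_3)
  then have f: "f 0 = 1" "f 1 = 1" "f 2 = 1" "f 3 = 2"
    by (simp_all add: f_def flip: numeral_2_eq_2)
  \<comment> \<open>Halving the index makes the Fibonacci recursion run in steps of two; the first
    four coefficients give the numerator.\<close>
  have "n = 0 \<or> n = 1 \<or> n = 2 \<or> n = 3 \<or> (\<exists>k. n = k + 4)" by presburger
  then consider "n = 0" | "n = 1" | "n = 2" | "n = 3" | k where "n = k + 4" by blast
  then have "f n - (if n < 2 then 0 else f (n - 2)) - (if n < 4 then 0 else f (n - 4)) =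
      fps_nth ?R n"
  proof cases
    case (5 k)
    have "Suc (k + 4) div 2 = Suc (Suc (Suc k div 2))" "Suc (k + 2) div 2 = Suc (Suc k div 2)"
      by simp_all
    then have "f (k + 4) = f (k + 2) + f k"
      unfolding f_def by simp
    then show ?thesis
      using 5 by simp
  qed (simp_all add: f[simplified])
  then show "fps_nth (?F * (1 - fps_X^2 - fps_X^4)) n = fps_nth ?R n"
    by (simp only: L)
qed

text \<open>The factor takes second differences. The extra \<open>fps_X\<close> corrects the
  coefficient at 1, which is \<open>4 - 2 = 2\<close> instead of \<open>fib 2 = 1\<close>.\<close>

lemma fps_semigroup_growth_A6:
  "Abs_fps (\<lambda>n. of_nat (semigroup_growth A6 n) :: rat) * (1 - fps_X)^2 =
    fps_X + Abs_fps (\<lambda>n. of_nat (fib (Suc n div 2 + 1)))" (is "?G * _ = ?R")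
proof (rule fps_ext)
  fix n :: nat
  have sq: "(1 - fps_X)^2 = (1 - 2 * fps_X + fps_X^2 :: rat fps)"
    by (simp add: power2_eq_square algebra_simps)
  define g where "g n = (of_nat (semigroup_growth A6 n) :: rat)" for n
  have L: "fps_nth (?G * (1 - fps_X)^2) n =
      g n - (if n = 0 then 0 else 2 * g (n - 1)) + (if n < 2 then 0 else g (n - 2))"
  proof -
    have "?G * (1 - fps_X)^2 = ?G - fps_const 2 * (?G * fps_X) + ?G * fps_X^2"
      unfolding sq by (simp add: algebra_simps numeral_fps_const)
    then show ?thesis
      by (simp add: fps_X_power_mult_right_nth g_def)
  qed
  consider "n = 0" | "n = 1" | k where "n = k + 2"
    by (metis One_nat_def add_2_eq_Suc' not0_implies_Suc)
  then have "g n - (if n = 0 then 0 else 2 * g (n - 1)) + (if n < 2 then 0 else g (n - 2)) =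
      fps_nth ?R n"
  proof cases
    case (3 k)
    have "(of_nat (semigroup_growth A6 (k + 2) + semigroup_growth A6 k) :: rat) =
        of_nat (2 * semigroup_growth A6 (k + 1) + fib ((k + 3) div 2 + 1))"
      by (simp only: semigroup_growth_A6_rec)
    then have "g (k + 2) - 2 * g (k + 1) + g k = of_nat (fib ((k + 3) div 2 + 1))"
      by (simp add: g_def)
    moreover have "Suc (k + 2) = k + 3" by simp
    ultimately have "g (k + 2) - 2 * g (k + 1) + g k = of_nat (fib (Suc (k + 2) div 2 + 1))"
      by (simp only:)
    then show ?thesis using 3 by simp
  qed (use semigroup_growth_A6_1 in \<open>simp_all add: g_def semigroup_growth_A6_0\<close>)
  then show "fps_nth (?G * (1 - fps_X)^2) n = fps_nth ?R n"
    by (simp only: L)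
qed

theorem theorem5p7:
  shows "has_presentation (automaton_monoid A6) (transformation A6) A6_relations \<and>
    Abs_fps (\<lambda>n. of_nat (automaton_growth A6 n) :: rat) =
      1 / (1 - fps_X)^2 *
        (2 * fps_X - 1 + (1 + fps_X + fps_X^3) / (1 - fps_X^2 - fps_X^4)) \<and>
    Abs_fps (\<lambda>n. of_nat (semigroup_growth A6 n) :: rat) =
      1 / (1 - fps_X)^2 *
        (fps_X + (1 + fps_X + fps_X^3) / (1 - fps_X^2 - fps_X^4))"
proof -
  let ?D = "1 - fps_X^2 - fps_X^4 :: rat fps" and ?Q = "(1 - fps_X)^2 :: rat fps"
  let ?H = "Abs_fps (\<lambda>n. of_nat (fib (Suc n div 2 + 1))) :: rat fps"
  let ?G = "Abs_fps (\<lambda>n. of_nat (semigroup_growth A6 n)) :: rat fps"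
  let ?A = "Abs_fps (\<lambda>n. of_nat (automaton_growth A6 n)) :: rat fps"
  let ?U = "Abs_fps (\<lambda>n. 1) :: rat fps"
  have D: "fps_nth ?D 0 \<noteq> 0" and Q: "fps_nth ?Q 0 \<noteq> 0"
    by (simp_all add: power2_eq_square)
  have H: "?H = (1 + fps_X + fps_X^3) / ?D"
    by (simp only: fps_fib_halved[symmetric] fps_divide_unit[OF D] mult.assoc
        inverse_mult_eq_1'[OF D] mult_1_right)
  have unfold_quotient: "F = 1 / ?Q * K" if "F * ?Q = K" for F K :: "rat fps"
  proof -
    have "1 / ?Q * K = F * (?Q * inverse ?Q)"
      by (simp only: that[symmetric] fps_divide_unit[OF Q] mult_1_left ac_simps)
    then show ?thesis
      by (simp only: inverse_mult_eq_1'[OF Q] mult_1_right)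
  qed
  \<comment> \<open>The difference is 1 also at \<open>n = 0\<close>, where the conventions give 1
    and 0.\<close>
  have G: "?G = ?A + ?U"
  proof (rule fps_ext)
    fix n
    show "fps_nth ?G n = fps_nth (?A + ?U) n"
    proof (cases "n = 0")
      case True
      then show ?thesis by (simp add: automaton_growth_def semigroup_growth_A6_0)
    next
      case False
      then show ?thesis using automaton_growth_A6[of n] by (simp flip: of_nat_Suc)
    qed
  qed
  have "?U * (1 - fps_X) = 1"
    by (rule fps_ext) (simp add: right_diff_distrib)
  then have U: "?U * ?Q = 1 - fps_X"
    by (simp add: power2_eq_square flip: mult.assoc)
  \<comment> \<open>Subtracting \<open>1 - fps_X\<close> turns the summand \<open>fps_X\<close> into
    \<open>2 * fps_X - 1\<close>.\<close>
  have "?A * ?Q = ?G * ?Q - ?U * ?Q"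
    unfolding G by (simp only: distrib_right add_diff_cancel_right')
  also have "\<dots> = 2 * fps_X - 1 + ?H"
    unfolding fps_semigroup_growth_A6 U by (simp add: algebra_simps)
  finally have A: "?A * ?Q = 2 * fps_X - 1 + ?H" .
  show ?thesis
    by (intro conjI presentation_A6 unfold_quotient[OF A, unfolded H]
        unfold_quotient[OF fps_semigroup_growth_A6, unfolded H])
qed

end
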